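(* Let $q$ be a prime power and $d\geq 1$, and write $(q-1)d+1=q^a m$ where $a\geq 0$ is an integer and $m$ is a positive integer not divisible by $q$. Then the Hamming graph $H(q,d)$ has an efficient $(1,k)$-dominating function for every integer $k$ with $1\leq k\leq (q-1)d+1$ that is a multiple of $m$. Moreover, if $q$ is prime, then for an integer $1\leq k\leq (q-1)d+1$, $H(q,d)$ has an efficient $(1,k)$-dominating function if and only if $k$ is a multiple of $m$.
   Context: For a graph $X$ and vertex $v$, $N[v]$ denotes the closed neighbourhood of $v$ (the neighbours of $v$ together with $v$), and for $f:V(X)\to\mathbb{R}$ and $S\subseteq V(X)$, $f(S)=\sum_{u\in S}f(u)$. For nonnegative integers $j,k$, a $(j,k)$-dominating function on $X$ is a function $f:V(X)\to\{0,1,\ldots,j\}$ such that $f(N[v])\geq k$ for every vertex $v$; it is efficient if $f(N[v])=k$ for every vertex $v$. The Hamming graph $H(q,d)$ has as vertex set the $d$-tuples over a set of $q$ symbols (for $q$ a prime power, one may take $GF(q)^d$), two tuples being adjacent if and only if they differ in exactly one coordinate; it is $(q-1)d$-regular on $q^d$ vertices. *)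

theory Defs
  imports "HOL-Number_Theory.Prime_Powers"
begin

text \<open>
  A graph is given by its vertex set and its adjacency relation; only the restriction of the
  relation to the vertex set is relevant.
\<close>
type_synonym 'v graph = "'v set \<times> ('v \<Rightarrow> 'v \<Rightarrow> bool)"

definition closed_nbhd :: "'v graph \<Rightarrow> 'v \<Rightarrow> 'v set" where
  "closed_nbhd X v = insert v {u \<in> fst X. snd X v u}"

text \<open>
  The values of \<open>f\<close> outside the vertex set are unconstrained and never used.
\<close>
definition dominating_function :: "nat \<Rightarrow> nat \<Rightarrow> 'v graph \<Rightarrow> ('v \<Rightarrow> nat) \<Rightarrow> bool" where
  "dominating_function j k X f \<longleftrightarrow>
     f ` fst X \<subseteq> {0..j} \<and> (\<forall>v\<in>fst X. sum f (closed_nbhd X v) \<ge> k)"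

definition efficient_dominating_function :: "nat \<Rightarrow> nat \<Rightarrow> 'v graph \<Rightarrow> ('v \<Rightarrow> nat) \<Rightarrow> bool" where
  "efficient_dominating_function j k X f \<longleftrightarrow>
     dominating_function j k X f \<and> (\<forall>v\<in>fst X. sum f (closed_nbhd X v) = k)"

text \<open>
  \<open>H(q,d)\<close> is \<open>hamming_graph S d\<close> for a set \<open>S\<close> of \<open>q\<close> symbols.
\<close>
definition hamming_graph :: "'a set \<Rightarrow> nat \<Rightarrow> 'a list graph" where
  "hamming_graph S d =
     ({x. set x \<subseteq> S \<and> length x = d}, \<lambda>x y. card {i. i < d \<and> x ! i \<noteq> y ! i} = 1)"

end

theory Submission
  imports "HOL-Algebra.Algebraic_Closure" "HOL-Number_Theory.Residues" Defs
begin

text \<open>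
  Let \<open>L\<close> be an algebraic closure of \<open>GF(p)\<close> with subfields \<open>K = GF(q)\<close> and \<open>G = GF(q^a)\<close>, and
  identify the \<open>q\<close> symbols with \<open>K\<close>. Choose \<open>h_1, \<dots>, h_d\<close> in \<open>G\<close> so that every one-dimensional
  \<open>K\<close>-subspace of \<open>G\<close> is spanned by exactly \<open>m\<close> of them and the remaining \<open>(m - 1) / (q - 1)\<close> are
  zero. Moving inside the closed neighbourhood of \<open>v\<close> changes the syndrome \<open>\<phi>(v) = \<Sum> v_i h_i\<close>
  by \<open>0\<close> or by a nonzero \<open>K\<close>-multiple of one \<open>h_i\<close>, so \<open>\<phi>\<close> takes each value of \<open>G\<close> exactly \<open>m\<close>
  times there. The preimage of any \<open>t\<close>-subset of \<open>G\<close> is then an efficient \<open>(1, tm)\<close>-dominating set.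

  Conversely, summing the domination condition over all vertices gives
  \<open>f(V) q^a m = k q^d\<close>, and for prime \<open>q\<close> the factor \<open>m\<close> is coprime to \<open>q\<close>.
\<close>

section \<open>Finite subfields of an algebraically closed field\<close>

lemma (in ring) add_pow_eq_zero:
  assumes "[p] \<cdot> \<one> = \<zero>" "p dvd n" "x \<in> carrier R"
  shows "[(n::nat)] \<cdot> x = \<zero>"
proof -
  obtain c where n: "n = p * c" using assms(2) by (elim dvdE)
  have "[p] \<cdot> x = ([p] \<cdot> \<one>) \<otimes> x"
    using assms(3) by (subst add_pow_ldistr) auto
  with assms have "[p] \<cdot> x = \<zero>" by simp
  with assms(3) show ?thesis
    using add.nat_pow_pow[of x c p] by (simp add: n)
qed

lemma (in ring_hom_ring) hom_add_pow:
  assumes "x \<in> carrier R"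
  shows "h ([(n::nat)] \<cdot> x) = [n] \<cdot>\<^bsub>S\<^esub> h x"
  using assms by (induction n) auto

text \<open>Induction by Pascal's rule: multiplication by \<open>b\<close> keeps the index
  \<open>k\<close>, multiplication by \<open>a\<close> shifts it. Splitting off \<open>k = 0\<close>
  puts both sums over \<open>{..n}\<close>, where they merge termwise.\<close>

lemma (in cring) binomial_finsum:
  assumes a: "a \<in> carrier R" and b: "b \<in> carrier R"
  shows "(a \<oplus> b) [^] (n::nat) = (\<Oplus>k\<in>{..n}. [(n choose k)] \<cdot> (a [^] k \<otimes> b [^] (n - k)))"
proof (induction n)
  case 0
  show ?case by (simp add: finsum_0)
next
  case (Suc n)
  have cl [simp]: "[j] \<cdot> (a [^] k \<otimes> b [^] l) \<in> carrier R" for j k l :: nat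
    using a b by simp
  have b_pow: "[j] \<cdot> (a [^] k \<otimes> b [^] l) \<otimes> b = [j] \<cdot> (a [^] k \<otimes> b [^] Suc l)" for j k l :: nat
    using a b by (simp add: add_pow_ldistr m_assoc)
  have a_pow: "[j] \<cdot> (a [^] k \<otimes> b [^] l) \<otimes> a = [j] \<cdot> (a [^] Suc k \<otimes> b [^] l)" for j k l :: nat
    using a b by (simp add: add_pow_ldistr m_assoc m_comm[of "b [^] l" a])
  have "(\<Oplus>k\<in>{..n}. [(n choose k)] \<cdot> (a [^] k \<otimes> b [^] (n - k))) \<otimes> b
      = (\<Oplus>k\<in>{..n}. [(n choose k)] \<cdot> (a [^] k \<otimes> b [^] (Suc n - k)))"
    using a b by (subst finsum_ldistr) (auto simp: b_pow Suc_diff_le simp del: nat_pow_Suc intro!: finsum_cong')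
  \<comment> \<open>The added top term is zero because \<open>n choose Suc n = 0\<close>.\<close>
  also have "\<dots> = (\<Oplus>k\<in>{..Suc n}. [(n choose k)] \<cdot> (a [^] k \<otimes> b [^] (Suc n - k)))"
    by (subst finsum_Suc) (auto simp: a b binomial_eq_0)
  also have "\<dots> = (\<Oplus>k\<in>{..n}. [(n choose Suc k)] \<cdot> (a [^] Suc k \<otimes> b [^] (n - k)))
                 \<oplus> [(Suc n choose 0)] \<cdot> (a [^] (0::nat) \<otimes> b [^] Suc n)"
    by (subst finsum_Suc2) (auto simp: a b simp del: nat_pow_Suc)
  finally have B: "(\<Oplus>k\<in>{..n}. [(n choose k)] \<cdot> (a [^] k \<otimes> b [^] (n - k))) \<otimes> b = \<dots>" .
  have A: "(\<Oplus>k\<in>{..n}. [(n choose k)] \<cdot> (a [^] k \<otimes> b [^] (n - k))) \<otimes> a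
      = (\<Oplus>k\<in>{..n}. [(n choose k)] \<cdot> (a [^] Suc k \<otimes> b [^] (n - k)))"
    using a b by (subst finsum_ldistr) (auto simp: a_pow simp del: nat_pow_Suc intro!: finsum_cong')
  have "(a \<oplus> b) [^] Suc n = (\<Oplus>k\<in>{..n}. [(n choose k)] \<cdot> (a [^] k \<otimes> b [^] (n - k))) \<otimes> (a \<oplus> b)"
    by (simp add: Suc.IH)
  also have "\<dots> = (\<Oplus>k\<in>{..n}. [(n choose k)] \<cdot> (a [^] Suc k \<otimes> b [^] (n - k)))
     \<oplus> ((\<Oplus>k\<in>{..n}. [(n choose Suc k)] \<cdot> (a [^] Suc k \<otimes> b [^] (n - k)))
                 \<oplus> [(Suc n choose 0)] \<cdot> (a [^] (0::nat) \<otimes> b [^] Suc n))"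
    using a b by (subst r_distr) (auto simp: A B simp del: nat_pow_Suc intro!: finsum_closed)
  also have "\<dots> = (\<Oplus>k\<in>{..n}. [(n choose k)] \<cdot> (a [^] Suc k \<otimes> b [^] (n - k)) \<oplus> [(n choose Suc k)] \<cdot> (a [^] Suc k \<otimes> b [^] (n - k)))
                 \<oplus> [(Suc n choose 0)] \<cdot> (a [^] (0::nat) \<otimes> b [^] Suc n)"
    using a b by (subst finsum_addf) (auto simp: a_assoc simp del: nat_pow_Suc)
  also have "\<dots> = (\<Oplus>k\<in>{..n}. [(Suc n choose Suc k)] \<cdot> (a [^] Suc k \<otimes> b [^] (n - k)))
                 \<oplus> [(Suc n choose 0)] \<cdot> (a [^] (0::nat) \<otimes> b [^] Suc n)"
    using a b by (simp add: add.nat_pow_mult del: nat_pow_Suc)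
  also have "\<dots> = (\<Oplus>k\<in>{..Suc n}. [(Suc n choose k)] \<cdot> (a [^] k \<otimes> b [^] (Suc n - k)))"
    by (subst finsum_Suc2) (auto simp: a b simp del: nat_pow_Suc)
  finally show ?case .
qed

lemma (in cring) frobenius_add:
  assumes p: "prime (p::nat)" "[p] \<cdot> \<one> = \<zero>" and a: "a \<in> carrier R" and b: "b \<in> carrier R"
  shows "(a \<oplus> b) [^] p = a [^] p \<oplus> b [^] p"
proof -
  \<comment> \<open>In this form the end terms of the expansion can be peeled off by the successor
    rules for sums. The indices \<open>1, ..., m + 1\<close> remain, and there \<open>p\<close>
    divides the binomial coefficient.\<close>
  obtain m where m: "p = Suc (Suc m)"
    using prime_ge_2_nat[OF p(1)] by (metis add_2_eq_Suc le_Suc_ex)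
  let ?f = "\<lambda>k. [(p choose k)] \<cdot> (a [^] k \<otimes> b [^] (p - k))"
  have cl: "?f k \<in> carrier R" for k
    using a b by simp
  have zero: "?f (Suc i) = \<zero>" if "i \<le> m" for i
  proof (rule add_pow_eq_zero[OF p(2)])
    show "p dvd (p choose Suc i)"
      by (rule dvd_choose_prime) (use that p(1) in \<open>auto simp: m\<close>)
  qed (use a b in simp)
  have "(a \<oplus> b) [^] p = (\<Oplus>k\<in>{..Suc (Suc m)}. ?f k)"
    using binomial_finsum[OF a b, of p] by (simp add: m)
  also have "\<dots> = ?f (Suc (Suc m)) \<oplus> ((\<Oplus>k\<in>{..m}. ?f (Suc k)) \<oplus> ?f 0)"
    using cl by (subst finsum_Suc, force, subst finsum_Suc2) force+
  also have "(\<Oplus>k\<in>{..m}. ?f (Suc k)) = \<zero>"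
    by (intro add.finprod_one_eqI zero) simp
  also have "?f (Suc (Suc m)) = a [^] p"
    using a b by (simp add: m)
  also have "?f 0 = b [^] p"
    using a b by simp
  finally show ?thesis using a b by simp
qed

lemma (in cring) frobenius_pow_add:
  assumes p: "prime (p::nat)" "[p] \<cdot> \<one> = \<zero>" and a: "a \<in> carrier R" and b: "b \<in> carrier R"
  shows "(a \<oplus> b) [^] (p ^ n) = a [^] (p ^ n) \<oplus> b [^] (p ^ n)"
proof (induction n)
  case (Suc n)
  have "(a \<oplus> b) [^] (p ^ Suc n) = ((a \<oplus> b) [^] (p ^ n)) [^] p"
    using a b by (simp add: nat_pow_pow mult.commute)
  also have "\<dots> = (a [^] (p ^ n)) [^] p \<oplus> (b [^] (p ^ n)) [^] p"
    using a b p by (simp add: Suc.IH frobenius_add)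
  finally show ?case using a b by (simp add: nat_pow_pow mult.commute)
qed (use a b in simp)

text \<open>Additivity applied to \<open>(a - b) + b\<close> avoids the sign
  \<open>(-1)^(p^n)\<close> and hence a case distinction on the parity of \<open>p\<close>.\<close>

lemma (in cring) frobenius_pow_minus:
  assumes p: "prime (p::nat)" "[p] \<cdot> \<one> = \<zero>" and a: "a \<in> carrier R" and b: "b \<in> carrier R"
  shows "(a \<ominus> b) [^] (p ^ n) = a [^] (p ^ n) \<ominus> b [^] (p ^ n)"
proof -
  have "a [^] (p ^ n) = (a \<ominus> b \<oplus> b) [^] (p ^ n)"
    using a b by (simp add: minus_eq a_assoc l_neg)
  also have "\<dots> = (a \<ominus> b) [^] (p ^ n) \<oplus> b [^] (p ^ n)"
    using a b by (intro frobenius_pow_add p) auto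
  finally show ?thesis
    using a b by (simp add: minus_eq a_assoc r_neg)
qed

lemma (in abelian_group) minus_minus_minus:
  assumes "x \<in> carrier G" "y \<in> carrier G" "z \<in> carrier G"
  shows "(x \<ominus> y) \<ominus> (x \<ominus> z) = z \<ominus> y"
proof -
  have "(x \<ominus> y) \<ominus> (x \<ominus> z) = (x \<oplus> \<ominus> x) \<oplus> (z \<ominus> y)"
    using assms by (simp add: a_minus_def minus_add a_ac)
  thus ?thesis using assms by (simp add: r_neg)
qed

text \<open>The fixed points are the roots of \<open>P = X^q - X\<close> with
  \<open>q = p^n\<close>. As \<open>n > 0\<close> gives \<open>q > 1\<close>, \<open>P\<close> has
  degree \<open>q\<close>; it splits, so it has \<open>q\<close> roots with multiplicity, and all of
  them are simple.\<close>

lemma (in field) card_frobenius_fixed: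
  assumes p: "prime (p::nat)" "[p] \<cdot> \<one> = \<zero>" and n: "n > 0"
    and split: "\<And>P. P \<in> carrier (poly_ring R) \<Longrightarrow> splitted P"
  shows "card {x \<in> carrier R. x [^] (p ^ n) = x} = p ^ n"
proof -
  define q where "q = p ^ n"
  have q: "q > 1"
    unfolding q_def using n prime_gt_1_nat[OF p(1)] by (metis one_less_power)
  hence q2: "2 + (q - 2) = q" by simp
  note sub = carrier_is_subring
  interpret U: domain "poly_ring R"
    using univ_poly_is_domain[OF sub] .
  interpret C: ring_hom_ring R "poly_ring R" poly_of_const
    using canonical_embedding_ring_hom[OF sub] by simp
  have pU: "[p] \<cdot>\<^bsub>poly_ring R\<^esub> \<one>\<^bsub>poly_ring R\<^esub> = \<zero>\<^bsub>poly_ring R\<^esub>"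
    using C.hom_add_pow[of "\<one>" p] by (simp add: p(2))
  have X [simp]: "X \<in> carrier (poly_ring R)"
    using var_closed(1)[OF sub] .
  define P where "P = X [^]\<^bsub>poly_ring R\<^esub> q \<ominus>\<^bsub>poly_ring R\<^esub> X"
  have P [simp]: "P \<in> carrier (poly_ring R)"
    unfolding P_def by simp
  have "degree (X [^]\<^bsub>poly_ring R\<^esub> q) = q"
    unfolding unitary_monom_eq_var_pow[OF sub, symmetric] monom_def by simp
  moreover have "degree (\<ominus>\<^bsub>poly_ring R\<^esub> X) = 1"
    using univ_poly_a_inv_length[OF sub X] by (simp add: var_def)
  ultimately have deg: "degree P = q"
    unfolding P_def a_minus_def univ_poly_add using q
    by (subst poly_add_degree_eq[OF sub]) (auto simp: univ_poly_carrier)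
  hence "P \<noteq> []" using q by auto
  have eval_P: "eval P x = x [^] q \<ominus> x" if x: "x \<in> carrier R" for x
  proof -
    interpret E: ring_hom_ring "poly_ring R" R "\<lambda>f. eval f x"
      using eval_ring_hom[OF sub x] .
    show ?thesis
      unfolding P_def a_minus_def by (simp add: E.hom_nat_pow eval_var x)
  qed
  have root_iff: "is_root P x \<longleftrightarrow> x \<in> carrier R \<and> x [^] q = x" for x
    unfolding is_root_def using eval_P[of x] \<open>P \<noteq> []\<close> by (metis nat_pow_closed r_right_minus_eq)
  \<comment> \<open>With \<open>l = X - x\<close>, Frobenius gives \<open>P = l^q - l\<close>, which \<open>l^2\<close> does not divide.\<close>
  have mult_le: "alg_mult P x \<le> 1" if x: "x \<in> carrier R" "x [^] q = x" for x
  proof (rule ccontr)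
    assume mult: "\<not> alg_mult P x \<le> 1"
    define l where "l = [\<one>, \<ominus> x]"
    have l_eq: "l = X \<ominus>\<^bsub>poly_ring R\<^esub> poly_of_const x"
    proof -
      have "X \<ominus>\<^bsub>poly_ring R\<^esub> poly_of_const x = X \<oplus>\<^bsub>poly_ring R\<^esub> poly_of_const (\<ominus> x)"
        using x by (simp add: a_minus_def)
      also have "\<dots> = l"
        using x by (auto simp: l_def univ_poly_add poly_of_const_def var_def)
      finally show ?thesis ..
    qed
    have l [simp]: "l \<in> carrier (poly_ring R)"
      unfolding l_eq using x by simp
    have "(l [^]\<^bsub>poly_ring R\<^esub> (2::nat)) pdivides P"
      unfolding l_def by (rule le_alg_mult_imp_pdivides) (use x mult in auto)
    then obtain r where r: "r \<in> carrier (poly_ring R)"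
      "P = l [^]\<^bsub>poly_ring R\<^esub> (2::nat) \<otimes>\<^bsub>poly_ring R\<^esub> r"
      unfolding pdivides_def factor_def by blast
    define s where "s = l [^]\<^bsub>poly_ring R\<^esub> (q - 2) \<ominus>\<^bsub>poly_ring R\<^esub> r"
    have s: "s \<in> carrier (poly_ring R)"
      unfolding s_def using r by simp
    have "l [^]\<^bsub>poly_ring R\<^esub> q = X [^]\<^bsub>poly_ring R\<^esub> q \<ominus>\<^bsub>poly_ring R\<^esub> poly_of_const x"
      unfolding l_eq q_def using x
      by (subst U.frobenius_pow_minus[OF p(1) pU]) (auto simp: q_def simp flip: C.hom_nat_pow)
    hence "l = l [^]\<^bsub>poly_ring R\<^esub> q \<ominus>\<^bsub>poly_ring R\<^esub> P"
      unfolding P_def using x by (simp add: l_eq U.minus_minus_minus)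
    also have "l [^]\<^bsub>poly_ring R\<^esub> q
        = l [^]\<^bsub>poly_ring R\<^esub> (2::nat) \<otimes>\<^bsub>poly_ring R\<^esub> l [^]\<^bsub>poly_ring R\<^esub> (q - 2)"
      using U.nat_pow_mult[OF l, of 2 "q - 2"] unfolding q2 by (rule sym)
    also have "\<dots> \<ominus>\<^bsub>poly_ring R\<^esub> P = l [^]\<^bsub>poly_ring R\<^esub> (2::nat) \<otimes>\<^bsub>poly_ring R\<^esub> s"
      unfolding r(2) s_def a_minus_def using r(1) by (simp add: U.r_distr U.r_minus)
    also have "\<dots> = l \<otimes>\<^bsub>poly_ring R\<^esub> (l \<otimes>\<^bsub>poly_ring R\<^esub> s)"
      using s by (simp add: numeral_2_eq_2 U.m_assoc)
    \<comment> \<open>Cancelling one factor \<open>l\<close> makes \<open>l\<close> a divisor of 1,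
      which is refuted by evaluating at its root \<open>x\<close>.\<close>
    finally have "l \<otimes>\<^bsub>poly_ring R\<^esub> \<one>\<^bsub>poly_ring R\<^esub> = l \<otimes>\<^bsub>poly_ring R\<^esub> (l \<otimes>\<^bsub>poly_ring R\<^esub> s)"
      by simp
    moreover have "l \<noteq> \<zero>\<^bsub>poly_ring R\<^esub>"
      by (simp add: l_def univ_poly_zero)
    ultimately have "\<one>\<^bsub>poly_ring R\<^esub> = l \<otimes>\<^bsub>poly_ring R\<^esub> s"
      using s by (subst (asm) U.m_lcancel) auto
    moreover interpret E: ring_hom_ring "poly_ring R" R "\<lambda>f. eval f x"
      using eval_ring_hom[OF sub x(1)] .
    have "eval l x = \<zero>"
      using x by (simp add: l_def r_neg)
    ultimately have "\<one> = \<zero>"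
      using E.hom_one E.hom_mult[OF l s] s by simp
    thus False by simp
  qed
  have "q = size (roots P)"
    using split[OF P] deg by (simp add: splitted_def)
  also have "\<dots> = (\<Sum>x\<in>set_mset (roots P). count (roots P) x)"
    by (simp add: size_multiset_overloaded_eq)
  also have "\<dots> = (\<Sum>x\<in>set_mset (roots P). 1)"
  proof (rule sum.cong)
    fix x assume "x \<in># roots P"
    moreover from this have "count (roots P) x \<le> 1"
      using mult_le[of x] roots_mem_iff_is_root[OF P] root_iff
      by (simp add: alg_mult_eq_count_roots[OF P])
    ultimately show "count (roots P) x = 1"
      by (metis count_greater_eq_one_iff le_antisym)
  qed simp
  also have "\<dots> = card {x \<in> carrier R. x [^] q = x}"
    by (simp, rule arg_cong[of _ _ card]) (auto simp: roots_mem_iff_is_root[OF P] root_iff)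
  finally show ?thesis by (simp add: q_def)
qed

text \<open>The field is an algebraic closure of the integers modulo \<open>p\<close>; its embedding
  transports \<open>p * 1 = 0\<close>. The element type is the one that the closure construction
  yields over coefficients of type \<open>int\<close>.\<close>

lemma exists_algebraically_closed_char:
  assumes "prime (p::nat)"
  obtains L :: "((int list \<times> nat) multiset \<Rightarrow> int) ring"
  where "algebraically_closed L" "[p] \<cdot>\<^bsub>L\<^esub> \<one>\<^bsub>L\<^esub> = \<zero>\<^bsub>L\<^esub>"
proof -
  interpret F: residues_prime p "residue_ring (int p)"
    using assms by (simp add: residues_prime_def)
  obtain L :: "((int list \<times> nat) multiset \<Rightarrow> int) ring"
    where L: "algebraic_closure L (F.indexed_const ` carrier (residue_ring (int p)))"
      and hom: "F.indexed_const \<in> ring_hom (residue_ring (int p)) L"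
    using F.exists_closure by blast
  interpret L: algebraic_closure L "F.indexed_const ` carrier (residue_ring (int p))"
    by (rule L)
  interpret H: ring_hom_ring "residue_ring (int p)" L F.indexed_const
    using hom by (intro ring_hom_ringI2) (auto simp: F.ring_axioms L.ring_axioms)
  have "[k] \<cdot>\<^bsub>residue_ring (int p)\<^esub> \<one>\<^bsub>residue_ring (int p)\<^esub> = int k mod int p" for k :: nat
    by (induction k) (auto simp: F.res_zero_eq F.res_one_eq F.res_add_eq mod_simps add.commute)
  hence "[p] \<cdot>\<^bsub>residue_ring (int p)\<^esub> \<one>\<^bsub>residue_ring (int p)\<^esub> = \<zero>\<^bsub>residue_ring (int p)\<^esub>"
    by (simp add: F.res_zero_eq)
  hence "[p] \<cdot>\<^bsub>L\<^esub> \<one>\<^bsub>L\<^esub> = \<zero>\<^bsub>L\<^esub>"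
    using H.hom_add_pow[of "\<one>\<^bsub>residue_ring (int p)\<^esub>" p] by simp
  thus ?thesis
    using L.algebraically_closed_axioms that by blast
qed

lemma (in field) subfield_frobenius_fixed:
  assumes p: "prime (p::nat)" "[p] \<cdot> \<one> = \<zero>"
  shows "subfield {x \<in> carrier R. x [^] (p ^ n) = x} R" (is "subfield ?K R")
proof (rule subfieldI')
  have p0: "p > 0" using p(1) by (rule prime_gt_0_nat)
  show "subring ?K R"
  proof (rule subringI)
    \<comment> \<open>Negation is treated as \<open>0 - x\<close>; since \<open>p > 0\<close>, the
      power of 0 is again 0.\<close>
    fix x assume "x \<in> ?K"
    thus "\<ominus> x \<in> ?K"
      using frobenius_pow_minus[OF p zero_closed, of x n] p0 by (simp add: a_minus_def nat_pow_zero)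
  next
    fix x y assume "x \<in> ?K" "y \<in> ?K"
    thus "x \<otimes> y \<in> ?K" "x \<oplus> y \<in> ?K"
      using frobenius_pow_add[OF p, of x y n] by (simp_all add: nat_pow_distrib)
  qed auto
next
  fix x assume x: "x \<in> ?K - {\<zero>}"
  hence u: "x \<in> Units R" by (simp add: field_Units)
  \<comment> \<open>The Frobenius power of \<open>inv x\<close> turns out to be an inverse of
    \<open>x\<close>, so it equals \<open>inv x\<close> by uniqueness.\<close>
  have "x \<otimes> (inv x) [^] (p ^ n) = x [^] (p ^ n) \<otimes> (inv x) [^] (p ^ n)"
    using x by simp
  also have "\<dots> = (x \<otimes> inv x) [^] (p ^ n)"
    using x u by (intro nat_pow_distrib[symmetric]) auto
  also have "\<dots> = \<one>"
    using u by simp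
  finally have "inv x = (inv x) [^] (p ^ n)"
    using x u by (intro comm_inv_char) auto
  thus "inv x \<in> ?K" using x u by simp
qed

text \<open>With \<open>q = p^n\<close>, the two fields are the fixed points of the
  \<open>p^n\<close>-th and \<open>p^(n * a)\<close>-th power maps. Both lie in one ambient field,
  so \<open>K\<close> is literally a subset of \<open>G\<close>: the second map is an iterate of the
  first.\<close>

lemma exists_subfields:
  assumes "primepow (q::nat)" "a > 0"
  obtains L :: "((int list \<times> nat) multiset \<Rightarrow> int) ring" and K G
  where "field L" "subfield K L" "subfield G L" "K \<subseteq> G" "card K = q" "card G = q ^ a"
proof -
  from assms(1) obtain p n where p: "prime p" "n > 0" "q = p ^ n"
    unfolding primepow_def by blast
  obtain L :: "((int list \<times> nat) multiset \<Rightarrow> int) ring"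
    where L: "algebraically_closed L" "[p] \<cdot>\<^bsub>L\<^esub> \<one>\<^bsub>L\<^esub> = \<zero>\<^bsub>L\<^esub>"
    using exists_algebraically_closed_char[OF p(1)] .
  interpret L: algebraically_closed L by (rule L)
  let ?F = "\<lambda>n. {x \<in> carrier L. x [^]\<^bsub>L\<^esub> (p ^ n) = x}"
  have iter: "x \<in> ?F (n * j)" if x: "x \<in> ?F n" for x j
  proof (induction j)
    case (Suc j)
    have "x [^]\<^bsub>L\<^esub> (p ^ (n * Suc j)) = (x [^]\<^bsub>L\<^esub> (p ^ n)) [^]\<^bsub>L\<^esub> (p ^ (n * j))"
      using x by (subst L.nat_pow_pow) (auto simp: power_add)
    with Suc x show ?case by simp
  qed (use x in auto)
  show ?thesis
  proof (rule that)
    show "field L" by (rule L.field_axioms)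
    show "subfield (?F n) L" "subfield (?F (n * a)) L"
      using L.subfield_frobenius_fixed[OF p(1) L(2)] by blast+
    show "?F n \<subseteq> ?F (n * a)" using iter by blast
    show "card (?F n) = q" "card (?F (n * a)) = q ^ a"
      using L.card_frobenius_fixed[OF p(1) L(2) _ L.roots_over_carrier, of n]
        L.card_frobenius_fixed[OF p(1) L(2) _ L.roots_over_carrier, of "n * a"] p assms(2)
      by (simp_all add: power_mult)
  qed
qed

section \<open>Closed neighbourhoods in Hamming graphs\<close>

lemma closed_nbhd_hamming_graph:
  assumes "v \<in> fst (hamming_graph S d)"
  shows "closed_nbhd (hamming_graph S d) v =
           insert v ((\<lambda>(i, s). v[i := s]) ` (SIGMA i:{..<d}. S - {v ! i}))" (is "_ = insert v ?A")
proof (intro equalityI subsetI)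
  have v: "set v \<subseteq> S" "length v = d"
    using assms by (auto simp: hamming_graph_def)
  {
    fix u assume "u \<in> closed_nbhd (hamming_graph S d) v"
    then consider "u = v" | "set u \<subseteq> S" "length u = d" "card {i. i < d \<and> v ! i \<noteq> u ! i} = 1"
      by (auto simp: closed_nbhd_def hamming_graph_def)
    thus "u \<in> insert v ?A"
    proof cases
      case 2
      then obtain i where i: "{i. i < d \<and> v ! i \<noteq> u ! i} = {i}"
        by (auto simp: card_1_singleton_iff)
      have "i \<in> {i. i < d \<and> v ! i \<noteq> u ! i}" unfolding i by simp
      hence "i < d" "u ! i \<noteq> v ! i" by auto
      moreover have "u = v[i := u ! i]"
      proof (rule nth_equalityI)
        fix j assume j: "j < length u"
        have "v ! j = u ! j" if "j \<noteq> i"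
        proof -
          have "j \<notin> {i. i < d \<and> v ! i \<noteq> u ! i}" unfolding i using that by simp
          thus ?thesis using j 2(2) by simp
        qed
        thus "u ! j = v[i := u ! i] ! j"
          using j 2(2) v(2) by (cases "j = i") auto
      qed (use 2 v in simp)
      moreover have "u ! i \<in> S"
        using 2 \<open>i < d\<close> by auto
      ultimately show ?thesis
        by (intro insertI2 image_eqI[of _ _ "(i, u ! i)"]) auto
    qed simp
  next
    fix u assume "u \<in> insert v ?A"
    then consider "u = v" | i s where "i < d" "s \<in> S" "s \<noteq> v ! i" "u = v[i := s]"
      by auto
    thus "u \<in> closed_nbhd (hamming_graph S d) v"
    proof cases
      case 2
      hence "{j. j < d \<and> v ! j \<noteq> u ! j} = {i}"
        using v by (auto simp: nth_list_update)
      thus ?thesis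
        using 2 v set_update_subset_insert[of v i s] by (auto simp: closed_nbhd_def hamming_graph_def)
    qed (simp add: closed_nbhd_def)
  }
qed

text \<open>Excluding the symbol \<open>v ! i\<close> forces a real change at coordinate
  \<open>i\<close>, so \<open>(i, s)\<close> can be recovered from \<open>v[i := s]\<close>, and
  \<open>v\<close> itself is never produced.\<close>

lemma sum_closed_nbhd_hamming_graph:
  assumes "finite S" "v \<in> fst (hamming_graph S d)"
  shows "sum f (closed_nbhd (hamming_graph S d) v) = f v + (\<Sum>i<d. \<Sum>s\<in>S - {v ! i}. f (v[i := s]))"
proof -
  let ?I = "SIGMA i:{..<d}. S - {v ! i}" and ?u = "\<lambda>(i, s). v[i := s]"
  have len: "length v = d"
    using assms by (auto simp: hamming_graph_def)
  have "inj_on ?u ?I"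
  proof (rule inj_onI)
    fix x y assume xy: "x \<in> ?I" "y \<in> ?I" "?u x = ?u y"
    obtain i s j t where "x = (i, s)" "y = (j, t)" by fastforce
    with xy show "x = y"
      using len by auto (metis nth_list_update_eq nth_list_update_neq)+
  qed
  moreover have "v \<notin> ?u ` ?I"
  proof
    assume "v \<in> ?u ` ?I"
    then obtain i s where "i < d" "s \<noteq> v ! i" "v = v[i := s]" by auto
    thus False using len by (metis nth_list_update_eq)
  qed
  ultimately show ?thesis
    using assms by (simp add: closed_nbhd_hamming_graph sum.reindex sum.Sigma case_prod_unfold)
qed

lemma card_hamming_graph:
  assumes "finite S"
  shows "finite (fst (hamming_graph S d))" "card (fst (hamming_graph S d)) = card S ^ d"
  using assms by (simp_all add: hamming_graph_def finite_lists_length_eq card_lists_length_eq)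

lemma card_closed_nbhd_hamming_graph:
  assumes "finite S" "v \<in> fst (hamming_graph S d)"
  shows "card (closed_nbhd (hamming_graph S d) v) = (card S - 1) * d + 1"
proof -
  have "card (S - {v ! i}) = card S - 1" if "i < d" for i
    using assms that by (intro card_Diff_singleton) (auto simp: hamming_graph_def)
  thus ?thesis
    using sum_closed_nbhd_hamming_graph[OF assms, of "\<lambda>_. 1 :: nat"] by simp
qed

text \<open>Double counting of pairs weighted by \<open>f\<close>: adjacency is symmetric, so each
  \<open>f u\<close> is counted once for every vertex of its own closed neighbourhood, and these all
  have the same size.\<close>

lemma efficient_dominating_function_hamming_graph_count:
  assumes "finite S" and f: "efficient_dominating_function j k (hamming_graph S d) f"
  shows "sum f (fst (hamming_graph S d)) * ((card S - 1) * d + 1) = k * card S ^ d"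
proof -
  let ?V = "fst (hamming_graph S d)"
  \<comment> \<open>Making adjacency reflexive presents closed neighbourhoods as filtered subsets of
    \<open>?V\<close>, the shape needed for interchanging the sums.\<close>
  define adj where "adj v u \<longleftrightarrow> u = v \<or> snd (hamming_graph S d) v u" for v u
  have sym: "adj v u \<longleftrightarrow> adj u v" for u v
    by (auto simp: adj_def hamming_graph_def eq_commute)
  have nb: "closed_nbhd (hamming_graph S d) v = {u \<in> ?V. adj v u}" if "v \<in> ?V" for v
    using that by (auto simp: closed_nbhd_def adj_def)
  note V = card_hamming_graph[OF assms(1), of d]
  have "k * card S ^ d = (\<Sum>v\<in>?V. sum f {u \<in> ?V. adj v u})"
    using f by (simp add: efficient_dominating_function_def nb V)
  also have "\<dots> = (\<Sum>u\<in>?V. \<Sum>v | v \<in> ?V \<and> adj v u. f u)"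
    using V by (intro sum.swap_restrict)
  also have "\<dots> = (\<Sum>u\<in>?V. f u * card (closed_nbhd (hamming_graph S d) u))"
    by (intro sum.cong) (auto simp: nb sym)
  also have "\<dots> = sum f ?V * ((card S - 1) * d + 1)"
    unfolding sum_distrib_right
    by (intro sum.cong) (simp_all only: card_closed_nbhd_hamming_graph[OF assms(1)])
  finally show ?thesis ..
qed

section \<open>Vertex labellings by a finite field\<close>

text \<open>The nonzero elements of \<open>K\<close> act on those of \<open>G\<close> by
  multiplication. The orbits partition \<open>G - {0}\<close> and all have size
  \<open>card K - 1\<close>; \<open>T\<close> picks one element from each, that is, one spanning
  vector per line of \<open>G\<close> over \<open>K\<close>.\<close>

lemma (in field) orbit_representatives:
  assumes K: "subfield K R" and G: "subfield G R" "finite G" "K \<subseteq> G"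
  shows "\<exists>T \<subseteq> G - {\<zero>}. card T * (card K - 1) = card G - 1 \<and>
    (\<forall>x\<in>G - {\<zero>}. \<exists>!t. t \<in> T \<and> x \<in> (\<lambda>c. c \<otimes> t) ` (K - {\<zero>}))"
proof -
  define orb where "orb x = (\<lambda>c. c \<otimes> x) ` (K - {\<zero>})" for x
  \<comment> \<open>The choice depends only on the set \<open>orb x\<close>, so elements with equal
    orbits receive the same representative; uniqueness below rests on this.\<close>
  define rep where "rep x = (SOME y. y \<in> orb x)" for x
  note subK = subfieldE(1)[OF K] and subG = subfieldE(1)[OF G(1)]
  have Kc: "K \<subseteq> carrier R" and Gc: "G \<subseteq> carrier R"
    using subringE(1) subK subG by auto
  have refl: "x \<in> orb x" if "x \<in> G" for x
    using that Gc subringE(3)[OF subK] unfolding orb_def by (intro image_eqI[of _ _ "\<one>"]) auto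
  have orb_G: "orb x \<subseteq> G - {\<zero>}" if "x \<in> G - {\<zero>}" for x
    using that Gc Kc G(3) subringE(6)[OF subG] unfolding orb_def by (auto simp: subset_iff integral_iff)
  have orb_eq: "orb y = orb x" if "x \<in> G - {\<zero>}" and y: "y \<in> orb x" for x y
  proof -
    obtain c where c: "c \<in> K" "c \<noteq> \<zero>" "y = c \<otimes> x"
      using y by (auto simp: orb_def)
    have x: "x \<in> carrier R" and cc: "c \<in> carrier R" using that Gc c Kc by auto
    have ic: "inv c \<in> K - {\<zero>}" using c subfield_m_inv(1)[OF K] by blast
    have ci: "c \<otimes> inv c = \<one>" using c cc field_Units by auto
    show ?thesis
    proof (intro equalityI subsetI)
      fix z assume "z \<in> orb y"
      then obtain e where "e \<in> K" "e \<noteq> \<zero>" "z = (e \<otimes> c) \<otimes> x"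
        using c cc x Kc by (auto simp: orb_def m_assoc subset_iff)
      moreover from this have "e \<otimes> c \<in> K - {\<zero>}"
        using c cc Kc subringE(6)[OF subK] by (auto simp: subset_iff integral_iff)
      ultimately show "z \<in> orb x" unfolding orb_def by blast
    next
      fix z assume "z \<in> orb x"
      then obtain e where e: "e \<in> K" "e \<noteq> \<zero>" "z = e \<otimes> x"
        by (auto simp: orb_def)
      have "z = e \<otimes> (c \<otimes> inv c) \<otimes> x" using e ci Kc by auto
      also have "\<dots> = (e \<otimes> inv c) \<otimes> y"
        using e c cc x ic Kc by (simp add: m_ac subset_iff)
      finally have "z = (e \<otimes> inv c) \<otimes> y" .
      moreover have "e \<otimes> inv c \<in> K - {\<zero>}"
        using e ic Kc subringE(6)[OF subK] by (auto simp: subset_iff integral_iff)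
      ultimately show "z \<in> orb y" unfolding orb_def by blast
    qed
  qed
  have rep: "rep x \<in> orb x" if "x \<in> G" for x
    using refl[OF that] unfolding rep_def by (rule someI)
  define T where "T = rep ` (G - {\<zero>})"
  have T: "T \<subseteq> G - {\<zero>}"
    using rep orb_G unfolding T_def by fast
  have uniq: "\<exists>!t. t \<in> T \<and> x \<in> orb t" if x: "x \<in> G - {\<zero>}" for x
  proof (rule ex1I[of _ "rep x"])
    have "x \<in> orb (rep x)"
      using orb_eq[OF x rep] refl[of x] x by simp
    thus "rep x \<in> T \<and> x \<in> orb (rep x)"
      using x by (auto simp: T_def)
  next
    fix t assume t: "t \<in> T \<and> x \<in> orb t"
    then obtain y where y: "y \<in> G - {\<zero>}" "t = rep y"
      by (auto simp: T_def)
    have "orb x = orb t" using orb_eq t T by blast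
    also have "\<dots> = orb y" using y rep[of y] orb_eq[of y "rep y"] by blast
    finally show "t = rep x" by (simp add: y(2) rep_def)
  qed
  have "card (orb t) = card K - 1" if "t \<in> T" for t
  proof -
    have "inj_on (\<lambda>c. c \<otimes> t) (K - {\<zero>})"
      using that T Kc Gc by (intro inj_onI) (auto simp: m_rcancel subset_iff)
    thus ?thesis
      unfolding orb_def using subringE(2)[OF subK] by (simp add: card_image)
  qed
  moreover have "card (\<Union>t\<in>T. orb t) = (\<Sum>t\<in>T. card (orb t))"
  proof (rule card_UN_disjoint)
    show "finite T" unfolding T_def using G(2) by blast
    show "\<forall>t\<in>T. finite (orb t)"
      unfolding orb_def using finite_subset[OF G(3,2)] by blast
    show "\<forall>t\<in>T. \<forall>u\<in>T. t \<noteq> u \<longrightarrow> orb t \<inter> orb u = {}"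
    proof (intro ballI impI equals0I)
      fix t u x assume tu: "t \<in> T" "u \<in> T" "t \<noteq> u" and x: "x \<in> orb t \<inter> orb u"
      have "x \<in> G - {\<zero>}" using tu(1) x orb_G T by blast
      from uniq[OF this] tu x show False by blast
    qed
  qed
  moreover have "(\<Union>t\<in>T. orb t) = G - {\<zero>}"
  proof (intro equalityI subsetI)
    fix x assume "x \<in> G - {\<zero>}"
    thus "x \<in> (\<Union>t\<in>T. orb t)" using ex1_implies_ex[OF uniq] by blast
  next
    fix x assume "x \<in> (\<Union>t\<in>T. orb t)"
    thus "x \<in> G - {\<zero>}" using orb_G T by blast
  qed
  moreover have "card (G - {\<zero>}) = card G - 1"
    using subringE(2)[OF subG] by simp
  ultimately have "card T * (card K - 1) = card G - 1" by simp
  moreover from uniq have "\<forall>x\<in>G - {\<zero>}. \<exists>!t. t \<in> T \<and> x \<in> orb t" ..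
  ultimately show ?thesis
    using T unfolding orb_def by (intro exI[of _ T] conjI)
qed

lemma sum_list_concat_replicate:
  "sum_list (map F (concat (replicate n xs))) = n * sum_list (map F xs)" for F :: "'b \<Rightarrow> nat"
  by (induction n) auto

text \<open>Take \<open>m\<close> copies of every orbit representative and fill up with zeros. A
  nonzero \<open>x\<close> is hit once by each copy of its representative; \<open>x = 0\<close> is
  hit only by the zero columns and by the extra summand, which stands for the unchanged
  vertex.\<close>

lemma (in field) exists_check_columns:
  assumes K: "subfield K R" and G: "subfield G R" "finite G" "K \<subseteq> G"
    and m: "m > 0" "(card K - 1) * d + 1 = card G * m"
  shows "\<exists>hs. length hs = d \<and> set hs \<subseteq> G \<and>
    (\<forall>x\<in>G. of_bool (x = \<zero>) + (\<Sum>i<d. \<Sum>c\<in>K - {\<zero>}. of_bool (c \<otimes> hs ! i = x)) = m)"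
proof -
  obtain T where T: "T \<subseteq> G - {\<zero>}" "card T * (card K - 1) = card G - 1"
    and uniq: "\<forall>x\<in>G - {\<zero>}. \<exists>!t. t \<in> T \<and> x \<in> (\<lambda>c. c \<otimes> t) ` (K - {\<zero>})"
    using orbit_representatives[OF K G] by (elim exE conjE)
  have Gc: "G \<subseteq> carrier R" and zG: "\<zero> \<in> G" "\<one> \<in> G"
    using subringE[OF subfieldE(1)[OF G(1)]] by auto
  have Kc: "K \<subseteq> carrier R" and zK: "\<zero> \<in> K" "\<one> \<in> K"
    using subringE[OF subfieldE(1)[OF K]] by auto
  have finK: "finite K" using G finite_subset by blast
  have finT: "finite T" using T(1) G(2) finite_subset by blast
  then obtain ts where ts: "set ts = T" "distinct ts"
    using finite_distinct_list by blast
  have "card {\<zero>, \<one>} \<le> card K"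
    using finK zK by (intro card_mono) auto
  hence K2: "card K \<ge> 2" by simp
  have "card G > 0" using G(2) zG by (auto simp: card_gt_0_iff)
  hence cG: "card G = card T * (card K - 1) + 1" using T(2) by simp
  have eq: "(card K - 1) * d + 1 = (card K - 1) * (card T * m) + m"
    unfolding m(2) cG by (simp add: algebra_simps)
  \<comment> \<open>Here \<open>m > 0\<close> pays for the 1 on the left of \<open>eq\<close>. The
    inequality makes the subtraction defining \<open>z\<close> exact.\<close>
  hence "(card K - 1) * (card T * m) \<le> (card K - 1) * d" using m(1) by linarith
  hence le: "card T * m \<le> d" using K2 by simp
  define z where "z = d - card T * m"
  have d: "d = card T * m + z" using le by (simp add: z_def)
  \<comment> \<open>This is exactly the count required at \<open>x = 0\<close>: each of the
    \<open>z\<close> zero columns contributes \<open>card K - 1\<close>.\<close>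
  have zm: "1 + z * (card K - 1) = m"
    using eq unfolding d by (simp add: algebra_simps)
  define hs where "hs = concat (replicate m ts) @ replicate z \<zero>"
  have len: "length hs = d"
    using distinct_card[OF ts(2)] by (simp add: hs_def d ts length_concat sum_list_replicate)
  have "set hs \<subseteq> G"
    using T(1) zG by (auto simp: hs_def ts)
  moreover have "of_bool (x = \<zero>) + (\<Sum>i<d. \<Sum>c\<in>K - {\<zero>}. of_bool (c \<otimes> hs ! i = x)) = m"
    if x: "x \<in> G" for x
  proof -
    define F where "F h = (\<Sum>c\<in>K - {\<zero>}. of_bool (c \<otimes> h = x) :: nat)" for h
    have F0: "F \<zero> = (if x = \<zero> then card K - 1 else 0)"
    proof -
      have "F \<zero> = (\<Sum>c\<in>K - {\<zero>}. of_bool (x = \<zero>))"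
        unfolding F_def using Kc by (intro sum.cong) auto
      thus ?thesis using zK by simp
    qed
    have FT: "F t = of_bool (x \<in> (\<lambda>c. c \<otimes> t) ` (K - {\<zero>}))" if "t \<in> T" for t
    proof -
      have inj: "inj_on (\<lambda>c. c \<otimes> t) (K - {\<zero>})"
        using that T Kc Gc by (intro inj_onI) (auto simp: m_rcancel subset_iff)
      have "F t = (\<Sum>y\<in>(\<lambda>c. c \<otimes> t) ` (K - {\<zero>}). of_bool (y = x))"
        unfolding F_def by (subst sum.reindex[OF inj]) simp
      also have "\<dots> = of_bool (x \<in> (\<lambda>c. c \<otimes> t) ` (K - {\<zero>}))"
        using finK by (simp add: of_bool_def sum.delta')
      finally show ?thesis .
    qed
    \<comment> \<open>Multiples of representatives by nonzero scalars are never 0, and a nonzero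
      \<open>x\<close> lies in the orbit of exactly one representative.\<close>
    have sumT: "(\<Sum>t\<in>T. F t) = (if x = \<zero> then 0 else 1)"
    proof (cases "x = \<zero>")
      case True
      have "F t = 0" if "t \<in> T" for t
        unfolding F_def
      proof (intro sum.neutral ballI)
        fix c assume "c \<in> K - {\<zero>}"
        hence "c \<otimes> t \<noteq> \<zero>" using that T(1) Kc Gc integral[of c t] by blast
        thus "of_bool (c \<otimes> t = x) = 0" using True by simp
      qed
      thus ?thesis using True by simp
    next
      case False
      with uniq x have "\<exists>!t. t \<in> T \<and> x \<in> (\<lambda>c. c \<otimes> t) ` (K - {\<zero>})"
        by (intro bspec[OF uniq]) simp
      then obtain t where t: "t \<in> T" "x \<in> (\<lambda>c. c \<otimes> t) ` (K - {\<zero>})"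
        "\<And>u. u \<in> T \<Longrightarrow> x \<in> (\<lambda>c. c \<otimes> u) ` (K - {\<zero>}) \<Longrightarrow> u = t"
        by blast
      have "(\<Sum>u\<in>T. F u) = (\<Sum>u\<in>T. of_bool (u = t))"
      proof (rule sum.cong)
        fix u assume u: "u \<in> T"
        have "x \<in> (\<lambda>c. c \<otimes> u) ` (K - {\<zero>}) \<longleftrightarrow> u = t"
          using t(2) t(3)[OF u] by blast
        thus "F u = of_bool (u = t)" by (simp only: FT[OF u])
      qed simp
      also have "\<dots> = 1"
        using finT t(1) by (simp add: of_bool_def sum.delta')
      finally show ?thesis using False by simp
    qed
    have "(\<Sum>i<d. F (hs ! i)) = sum_list (map F hs)"
      by (simp add: sum_list_sum_nth len atLeast0LessThan)
    also have "\<dots> = m * (\<Sum>t\<in>T. F t) + z * F \<zero>"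
      using ts by (simp add: hs_def sum_list_concat_replicate sum_list_distinct_conv_sum_set sum_list_replicate)
    finally show ?thesis
      using zm by (simp add: F_def[symmetric] sumT F0)
  qed
  ultimately show ?thesis using len by (intro exI[of _ hs] conjI ballI)
qed

text \<open>Only the summand at \<open>i\<close> changes; the common rest is \<open>A\<close>.
  Closure of \<open>b\<close> is assumed just for the symbols that occur, as \<open>b\<close> is
  arbitrary outside the symbol set.\<close>

lemma (in field) finsum_list_update:
  assumes "length hs = d" "set hs \<subseteq> carrier R" "length v = d" "i < d"
    and b: "\<And>s. s \<in> insert t (set v) \<Longrightarrow> b s \<in> carrier R"
  shows "(\<Oplus>j\<in>{..<d}. b (v[i := t] ! j) \<otimes> hs ! j)
       = (\<Oplus>j\<in>{..<d}. b (v ! j) \<otimes> hs ! j) \<oplus> (b t \<ominus> b (v ! i)) \<otimes> hs ! i"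
proof -
  have split: "{..<d} = insert i ({..<d} - {i})"
    using assms by auto
  have cl: "hs ! j \<in> carrier R" "b (v ! j) \<in> carrier R" if "j < d" for j
    using assms that by auto
  have bt: "b t \<in> carrier R" using b by simp
  define A where "A = (\<Oplus>j\<in>{..<d} - {i}. b (v ! j) \<otimes> hs ! j)"
  have A: "A \<in> carrier R"
    unfolding A_def using cl by (intro finsum_closed) auto
  have "(\<Oplus>j\<in>{..<d}. b (v[i := t] ! j) \<otimes> hs ! j)
      = b t \<otimes> hs ! i \<oplus> (\<Oplus>j\<in>{..<d} - {i}. b (v[i := t] ! j) \<otimes> hs ! j)"
    using cl bt assms by (subst split, subst finsum_insert) (auto simp: nth_list_update)
  also have "(\<Oplus>j\<in>{..<d} - {i}. b (v[i := t] ! j) \<otimes> hs ! j) = A"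
    unfolding A_def using cl assms by (intro finsum_cong') auto
  finally have 1: "(\<Oplus>j\<in>{..<d}. b (v[i := t] ! j) \<otimes> hs ! j) = b t \<otimes> hs ! i \<oplus> A" .
  have 2: "(\<Oplus>j\<in>{..<d}. b (v ! j) \<otimes> hs ! j) = b (v ! i) \<otimes> hs ! i \<oplus> A"
    unfolding A_def using cl assms by (subst split, subst finsum_insert) auto
  show ?thesis
    unfolding 1 2 using cl[OF assms(4)] bt A
    by (simp add: a_minus_def l_distr l_minus a_ac r_neg r_neg1 r_neg2)
qed

text \<open>The labelling is the syndrome. Replacing \<open>v ! i\<close> by \<open>s\<close> adds
  \<open>(b s - b (v ! i)) * hs ! i\<close>, and these differences run through
  \<open>K - {0}\<close>, so the counts are those of the chosen columns.\<close>

lemma (in field) hamming_graph_equidistributed: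
  assumes S: "finite S" and b: "bij_betw b S K"
    and K: "subfield K R" and G: "subfield G R" "finite G" "K \<subseteq> G"
    and m: "m > 0" "(card K - 1) * d + 1 = card G * m"
  shows "\<exists>\<phi>. \<forall>v\<in>fst (hamming_graph S d). \<forall>g\<in>G.
    (\<Sum>u\<in>closed_nbhd (hamming_graph S d) v. of_bool (\<phi> u = g)) = m"
proof -
  obtain hs where hs: "length hs = d" "set hs \<subseteq> G" and count:
    "\<forall>x\<in>G. of_bool (x = \<zero>) + (\<Sum>i<d. \<Sum>c\<in>K - {\<zero>}. of_bool (c \<otimes> hs ! i = x)) = m"
    using exists_check_columns[OF K G m] by (elim exE conjE)
  note subK = subfieldE(1)[OF K] and subG = subfieldE(1)[OF G(1)]
  have Gc: "G \<subseteq> carrier R" and Kc: "K \<subseteq> carrier R"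
    using subringE(1) subK subG by auto
  define \<phi> where "\<phi> v = (\<Oplus>j\<in>{..<d}. b (v ! j) \<otimes> hs ! j)" for v
  have bS: "b s \<in> K" if "s \<in> S" for s
    using b that by (auto simp: bij_betw_def)
  have "(\<Sum>u\<in>closed_nbhd (hamming_graph S d) v. of_bool (\<phi> u = g)) = m"
    if vV: "v \<in> fst (hamming_graph S d)" and g: "g \<in> G" for v g
  proof -
    have v: "set v \<subseteq> S" "length v = d"
      using vV by (auto simp: hamming_graph_def)
    have term_G: "b (v ! j) \<otimes> hs ! j \<in> G" if "j < d" for j
    proof (rule subringE(6)[OF subG])
      show "b (v ! j) \<in> G" using that v bS[of "v ! j"] G(3) nth_mem[of j v] by blast
    qed (use that hs in auto)
    have sum_G: "(\<Oplus>j\<in>J. b (v ! j) \<otimes> hs ! j) \<in> G" if "finite J" "J \<subseteq> {..<d}" for J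
      using that
    proof (induction J)
      case empty
      show ?case using subringE(2)[OF subG] by simp
    next
      case (insert j J)
      hence "(\<Oplus>j\<in>insert j J. b (v ! j) \<otimes> hs ! j) = b (v ! j) \<otimes> hs ! j \<oplus> (\<Oplus>j\<in>J. b (v ! j) \<otimes> hs ! j)"
        using term_G Gc by (intro finsum_insert) auto
      with insert show ?case using term_G subringE(7)[OF subG] by auto
    qed
    hence \<phi>G: "\<phi> v \<in> G" unfolding \<phi>_def by simp
    \<comment> \<open>The change of syndrome that leads from \<open>v\<close> to the label
      \<open>g\<close>.\<close>
    define x where "x = g \<ominus> \<phi> v"
    have xG: "x \<in> G"
      unfolding x_def a_minus_def using g \<phi>G subringE(5,7)[OF subG] by auto
    have shift: "\<phi> v \<oplus> y = g \<longleftrightarrow> y = x" if "y \<in> carrier R" for y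
    proof -
      have "\<phi> v \<oplus> x = g"
        unfolding x_def a_minus_def using g \<phi>G Gc by (auto simp: a_ac r_neg1 r_neg2 r_neg subset_iff)
      thus ?thesis
        using that \<phi>G xG Gc add.l_cancel[of "\<phi> v" y x] by auto
    qed
    have inner: "(\<Sum>s\<in>S - {v ! i}. of_bool (\<phi> (v[i := s]) = g))
        = (\<Sum>c\<in>K - {\<zero>}. of_bool (c \<otimes> hs ! i = x))" if i: "i < d" for i
    proof -
      have vi: "v ! i \<in> S" using v i by auto
      have hi: "hs ! i \<in> carrier R" using hs i Gc nth_mem[of i hs] by blast
      have bij: "bij_betw (\<lambda>s. b s \<ominus> b (v ! i)) (S - {v ! i}) (K - {\<zero>})"
      proof (rule bij_betw_imageI)
        show "inj_on (\<lambda>s. b s \<ominus> b (v ! i)) (S - {v ! i})"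
          using b bS vi Kc by (intro inj_onI) (auto simp: a_minus_def bij_betw_def inj_on_def subset_iff)
        show "(\<lambda>s. b s \<ominus> b (v ! i)) ` (S - {v ! i}) = K - {\<zero>}"
        proof (intro equalityI subsetI)
          fix c assume "c \<in> (\<lambda>s. b s \<ominus> b (v ! i)) ` (S - {v ! i})"
          then obtain s where s: "s \<in> S" "s \<noteq> v ! i" "c = b s \<ominus> b (v ! i)" by auto
          have "b s \<noteq> b (v ! i)" using s vi b by (auto simp: bij_betw_def inj_on_def)
          hence "c \<noteq> \<zero>" using s bS vi Kc by (auto simp: subset_iff r_right_minus_eq)
          moreover have "c \<in> K"
            unfolding s(3) a_minus_def using s bS vi subringE(5,7)[OF subK] by auto
          ultimately show "c \<in> K - {\<zero>}" by simp
        next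
          fix c assume c: "c \<in> K - {\<zero>}"
          have "c \<oplus> b (v ! i) \<in> K" using c bS vi subringE(7)[OF subK] by auto
          then obtain s where s: "s \<in> S" "b s = c \<oplus> b (v ! i)"
            using b by (auto simp: bij_betw_def)
          have cc: "c \<in> carrier R" "b (v ! i) \<in> carrier R" using c bS vi Kc by auto
          have "c = b s \<ominus> b (v ! i)"
            using cc by (simp add: s a_minus_def a_assoc r_neg)
          moreover have "s \<noteq> v ! i" using s cc c by auto
          ultimately show "c \<in> (\<lambda>s. b s \<ominus> b (v ! i)) ` (S - {v ! i})" using s by blast
        qed
      qed
      have "\<phi> (v[i := s]) = g \<longleftrightarrow> (b s \<ominus> b (v ! i)) \<otimes> hs ! i = x" if s: "s \<in> S" for s
      proof -
        have "\<phi> (v[i := s]) = \<phi> v \<oplus> (b s \<ominus> b (v ! i)) \<otimes> hs ! i"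
          unfolding \<phi>_def
          by (rule finsum_list_update) (use hs Gc v i s bS Kc in \<open>auto simp: subset_iff\<close>)
        moreover have "(b s \<ominus> b (v ! i)) \<otimes> hs ! i \<in> carrier R"
          using hi bS[OF s] bS[OF vi] Kc by blast
        ultimately show ?thesis using shift by simp
      qed
      hence "(\<Sum>s\<in>S - {v ! i}. of_bool (\<phi> (v[i := s]) = g))
          = (\<Sum>s\<in>S - {v ! i}. of_bool ((b s \<ominus> b (v ! i)) \<otimes> hs ! i = x))"
        by (intro sum.cong) auto
      also have "\<dots> = (\<Sum>c\<in>K - {\<zero>}. of_bool (c \<otimes> hs ! i = x))"
        by (rule sum.reindex_bij_betw[OF bij])
      finally show ?thesis .
    qed
    \<comment> \<open>The vertex \<open>v\<close> itself accounts for the separate summand in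
      \<open>count\<close>.\<close>
    have "\<phi> v = g \<longleftrightarrow> x = \<zero>"
      using shift[of \<zero>] \<phi>G Gc by auto
    thus ?thesis
      using bspec[OF count xG] by (simp add: sum_closed_nbhd_hamming_graph[OF S vV] inner)
  qed
  thus ?thesis by blast
qed

text \<open>Use the indicator of a union of \<open>t\<close> label classes: these are disjoint, and
  each meets every closed neighbourhood in \<open>m\<close> vertices.\<close>

lemma efficient_dominating_function_of_equidistributed:
  assumes "finite G" "t \<le> card G"
    and "\<forall>v\<in>fst H. \<forall>g\<in>G. (\<Sum>u\<in>closed_nbhd H v. of_bool (\<phi> u = g)) = m"
  shows "\<exists>f. efficient_dominating_function 1 (t * m) H f"
proof -
  obtain T where T: "T \<subseteq> G" "card T = t" "finite T"
    using obtain_subset_with_card_n[OF assms(2)] by blast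
  have "(\<Sum>u\<in>closed_nbhd H v. of_bool (\<phi> u \<in> T)) = t * m" if v: "v \<in> fst H" for v
  proof -
    have "(\<Sum>u\<in>closed_nbhd H v. of_bool (\<phi> u \<in> T))
        = (\<Sum>u\<in>closed_nbhd H v. \<Sum>g\<in>T. of_bool (\<phi> u = g))"
      using T(3) by (intro sum.cong) (auto simp: of_bool_def)
    also have "\<dots> = (\<Sum>g\<in>T. \<Sum>u\<in>closed_nbhd H v. of_bool (\<phi> u = g))"
      by (rule sum.swap)
    also have "\<dots> = (\<Sum>g\<in>T. m)"
      using T v assms(3) by (intro sum.cong) auto
    finally show ?thesis using T by simp
  qed
  hence "efficient_dominating_function 1 (t * m) H (\<lambda>u. of_bool (\<phi> u \<in> T))"
    by (auto simp: efficient_dominating_function_def dominating_function_def)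
  thus ?thesis by blast
qed

lemma hamming_graph_efficient_dominating_function:
  assumes "primepow (card S)" "(card S - 1) * d + 1 = card S ^ a * m" "m > 0" "t \<le> card S ^ a"
  shows "\<exists>f. efficient_dominating_function 1 (t * m) (hamming_graph S d) f"
proof -
  have S: "finite S"
    using assms(1) primepow_gt_0_nat[of "card S"] by (simp add: card_gt_0_iff)
  show ?thesis
  proof (cases "a = 0")
    \<comment> \<open>For \<open>a = 0\<close> the label set would have one element and cannot be a
      field. A constant label does instead, since \<open>m\<close> is then the size of a closed
      neighbourhood.\<close>
    case True
    have "card (closed_nbhd (hamming_graph S d) v) = m" if "v \<in> fst (hamming_graph S d)" for v
      using card_closed_nbhd_hamming_graph[OF S that] assms(2) True by simp
    thus ?thesis
      using assms(4) True
      by (intro efficient_dominating_function_of_equidistributed[where G = "{()}" and \<phi> = "\<lambda>_. ()"]) auto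
  next
    case False
    then obtain L :: "((int list \<times> nat) multiset \<Rightarrow> int) ring" and K G
      where L: "field L" "subfield K L" "subfield G L" "K \<subseteq> G" "card K = card S" "card G = card S ^ a"
      using exists_subfields[OF assms(1), of a] by auto
    interpret field L by (rule L)
    have "card S > 0" using S assms(1) primepow_gt_0_nat[of "card S"] by simp
    hence fin': "finite K" "finite G"
      using L(5,6) by (auto intro!: card_ge_0_finite)
    then obtain b where "bij_betw b S K"
      using finite_same_card_bij[OF S fin'(1)] L(5) by auto
    hence "\<exists>\<phi>. \<forall>v\<in>fst (hamming_graph S d). \<forall>g\<in>G.
        (\<Sum>u\<in>closed_nbhd (hamming_graph S d) v. of_bool (\<phi> u = g)) = m"
      by (rule hamming_graph_equidistributed[OF S _ L(2,3) fin'(2) L(4) assms(3)]) (simp only: L(5,6) assms(2))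
    thus ?thesis
      using assms(4) by (elim exE) (intro efficient_dominating_function_of_equidistributed[OF fin'(2)], simp_all only: L(6))
  qed
qed

theorem theorem6p1:
  fixes q d a m :: nat and S :: "'a set"
  assumes "primepow q" and "d \<ge> 1"
    and "finite S" and "card S = q"
    and "(q - 1) * d + 1 = q ^ a * m" and "m > 0" and "\<not> q dvd m"
  shows "(\<forall>k. 1 \<le> k \<and> k \<le> (q - 1) * d + 1 \<and> m dvd k \<longrightarrow>
            (\<exists>f. efficient_dominating_function 1 k (hamming_graph S d) f)) \<and>
         (prime q \<longrightarrow>
            (\<forall>k. 1 \<le> k \<and> k \<le> (q - 1) * d + 1 \<longrightarrow>
               ((\<exists>f. efficient_dominating_function 1 k (hamming_graph S d) f) \<longleftrightarrow> m dvd k)))"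
proof -
  have exist: "\<exists>f. efficient_dominating_function 1 k (hamming_graph S d) f"
    if k: "k \<le> (q - 1) * d + 1" "m dvd k" for k
  proof -
    from k(2) obtain t where "k = m * t" by (elim dvdE)
    hence t: "k = t * m" by simp
    hence "t \<le> q ^ a" using k(1) assms(5,6) by simp
    thus ?thesis
      unfolding t using assms by (intro hamming_graph_efficient_dominating_function[of S d a m]) auto
  qed
  moreover have "m dvd k"
    if q: "prime q" and f: "efficient_dominating_function 1 k (hamming_graph S d) f" for k f
  proof -
    \<comment> \<open>Primality is essential here: for a proper prime power, \<open>m\<close> may
      share a factor with \<open>q\<close> without being divisible by it.\<close>
    have "coprime q m" using q assms(7) by (rule prime_imp_coprime)
    hence "coprime m (q ^ d)" by (simp add: coprime_commute)
    \<comment> \<open>Double counting gives \<open>f(V) * q^a * m = k * q^d\<close>.\<close>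
    moreover have "m dvd k * q ^ d"
      using efficient_dominating_function_hamming_graph_count[OF assms(3) f]
      unfolding assms(4,5) by (intro dvdI[of _ _ "sum f (fst (hamming_graph S d)) * q ^ a"]) (simp add: ac_simps)
    ultimately show ?thesis by (simp add: coprime_dvd_mult_left_iff)
  qed
  ultimately show ?thesis by blast
qed

end
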